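(* Let $(\Omega,\mathcal E,P)$ be a probability space, $\mathcal F$ a $\sigma$-subalgebra of $\mathcal E$, $1\le r\le p<+\infty$, and let $f:L^p(\mathcal E)\to L^r(\mathcal F)$ be an $L^0(\mathcal F)$-convex $L^p$-conditional risk measure. Then there is a unique $L^0(\mathcal F)$-convex $L^p_{\mathcal F}(\mathcal E)$-conditional risk measure $\bar f:L^p_{\mathcal F}(\mathcal E)\to L^0(\mathcal F)$ such that $\bar f|_{L^p(\mathcal E)}=f$.
   Context: $L^0(\mathcal E)$, $L^0(\mathcal F)$ are the algebras of (a.s.-equality) equivalence classes of real $\mathcal E$-, respectively $\mathcal F$-, measurable random variables with the a.s. order; $L^0_+(\mathcal F)=\{\xi\in L^0(\mathcal F):\xi\ge0\}$. $L^p(\mathcal E)$, $L^p(\mathcal F)$, $L^r(\mathcal F)$ are the usual Lebesgue spaces. For $x\in L^0(\mathcal E)$, $|||x|||_p=E[|x|^p|\mathcal F]^{1/p}$, and $L^p_{\mathcal F}(\mathcal E)=\{x\in L^0(\mathcal E):|||x|||_p\in L^0_+(\mathcal F)\}$. An $L^p$-conditional risk measure ($1\le r\le p<\infty$) is a function $f:L^p(\mathcal E)\to L^r(\mathcal F)$ with $f(x)\le f(y)$ whenever $x\ge y$ in $L^p(\mathcal E)$, and $f(x+y)=f(x)-y$ for all $x\in L^p(\mathcal E)$, $y\in L^p(\mathcal F)$. A function $\bar f:L^p_{\mathcal F}(\mathcal E)\to L^0(\mathcal F)$ is an $L^p_{\mathcal F}(\mathcal E)$-conditional risk measure if $\bar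 f(x)\le\bar f(y)$ whenever $x\ge y$ in $L^p_{\mathcal F}(\mathcal E)$, and $\bar f(x+y)=\bar f(x)-y$ for $x\in L^p_{\mathcal F}(\mathcal E)$, $y\in L^0(\mathcal F)$. Either kind of function is $L^0(\mathcal F)$-convex if $f(\xi x+(1-\xi)y)\le\xi f(x)+(1-\xi)f(y)$ for all $x,y$ in its domain and $\xi\in L^0_+(\mathcal F)$ with $0\le\xi\le1$. *)

theory Defs
  imports "HOL-Probability.Probability"
begin

section \<open>Almost sure equality classes of random variables\<close>

definition ae_eq :: "'a measure \<Rightarrow> (('a \<Rightarrow> real) \<times> ('a \<Rightarrow> real)) set" where
  "ae_eq M = {(X, Y). X \<in> borel_measurable M \<and> Y \<in> borel_measurable M \<and> (AE w in M. X w = Y w)}"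

abbreviation ae_class :: "'a measure \<Rightarrow> ('a \<Rightarrow> real) \<Rightarrow> ('a \<Rightarrow> real) set" where
  "ae_class M X \<equiv> ae_eq M `` {X}"

text \<open>For a subalgebra \<open>F\<close> of \<open>M\<close>, an element of \<open>L\<^sup>0(F)\<close> is represented by the class, in the
  algebra of \<open>M\<close>, of an \<open>F\<close>-measurable function. This is the usual identification of
  \<open>L\<^sup>0(F)\<close> with a subset of \<open>L\<^sup>0(M)\<close>, which the expression \<open>x + y\<close> with
  \<open>x \<in> L\<^sup>0(M)\<close> and \<open>y \<in> L\<^sup>0(F)\<close> presupposes. \<open>L\<^sup>0(M)\<close> itself is \<open>L0 M M\<close>.\<close>

definition L0 :: "'a measure \<Rightarrow> 'a measure \<Rightarrow> ('a \<Rightarrow> real) set set" where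
  "L0 M F = borel_measurable F // ae_eq M"

definition ae_le :: "'a measure \<Rightarrow> ('a \<Rightarrow> real) set \<Rightarrow> ('a \<Rightarrow> real) set \<Rightarrow> bool" where
  "ae_le M x y \<longleftrightarrow> (\<forall>X\<in>x. \<forall>Y\<in>y. AE w in M. X w \<le> Y w)"

text \<open>Pointwise operations descend to classes; all members of the union below coincide
  (see \<open>lift2_ae_class\<close>).\<close>

definition lift2 ::
  "'a measure \<Rightarrow> (real \<Rightarrow> real \<Rightarrow> real) \<Rightarrow> ('a \<Rightarrow> real) set \<Rightarrow> ('a \<Rightarrow> real) set \<Rightarrow> ('a \<Rightarrow> real) set" where
  "lift2 M h x y = (\<Union>X\<in>x. \<Union>Y\<in>y. ae_class M (\<lambda>w. h (X w) (Y w)))"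

abbreviation ae_plus where "ae_plus M \<equiv> lift2 M (+)"
abbreviation ae_minus where "ae_minus M \<equiv> lift2 M (-)"
abbreviation ae_times where "ae_times M \<equiv> lift2 M (*)"
abbreviation ae_zero where "ae_zero M \<equiv> ae_class M (\<lambda>_. 0)"
abbreviation ae_one where "ae_one M \<equiv> ae_class M (\<lambda>_. 1)"

definition L0_plus :: "'a measure \<Rightarrow> 'a measure \<Rightarrow> ('a \<Rightarrow> real) set set" where
  "L0_plus M F = {\<xi> \<in> L0 M F. ae_le M (ae_zero M) \<xi>}"

lemma equiv_ae_eq: "equiv (borel_measurable M) (ae_eq M)"
proof (rule equivI)
  show "ae_eq M \<subseteq> borel_measurable M \<times> borel_measurable M"
    by (auto simp: ae_eq_def)
  show "refl_on (borel_measurable M) (ae_eq M)"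
    by (auto simp: refl_on_def ae_eq_def)
  show "sym (ae_eq M)"
    by (auto simp: sym_def ae_eq_def elim: AE_mp)
  show "trans (ae_eq M)"
    unfolding trans_def ae_eq_def by (auto elim!: AE_mp)
qed

lemma lift2_ae_class:
  assumes h: "case_prod h \<in> borel_measurable (borel \<Otimes>\<^sub>M borel)"
    and X: "X \<in> borel_measurable M" and Y: "Y \<in> borel_measurable M"
  shows "lift2 M h (ae_class M X) (ae_class M Y) = ae_class M (\<lambda>w. h (X w) (Y w))"
proof -
  have meas: "(\<lambda>w. h (U w) (V w)) \<in> borel_measurable M"
    if "U \<in> borel_measurable M" "V \<in> borel_measurable M" for U V
    using measurable_compose[OF measurable_Pair[OF that] h] by simp
  have "ae_class M (\<lambda>w. h (U w) (V w)) = ae_class M (\<lambda>w. h (X w) (Y w))"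
    if "U \<in> ae_class M X" "V \<in> ae_class M Y" for U V
  proof (rule equiv_class_eq[OF equiv_ae_eq])
    have U: "U \<in> borel_measurable M" "AE w in M. X w = U w"
      and V: "V \<in> borel_measurable M" "AE w in M. Y w = V w"
      using that by (auto simp: ae_eq_def)
    have "AE w in M. h (U w) (V w) = h (X w) (Y w)"
      using U(2) V(2) by eventually_elim simp
    then show "(\<lambda>w. h (U w) (V w), \<lambda>w. h (X w) (Y w)) \<in> ae_eq M"
      using meas[OF U(1) V(1)] meas[OF X Y] by (simp add: ae_eq_def)
  qed
  moreover have "X \<in> ae_class M X" "Y \<in> ae_class M Y"
    using X Y by (auto simp: ae_eq_def)
  ultimately show ?thesis
    unfolding lift2_def by blast
qed

lemma ae_le_ae_class:
  assumes "X \<in> borel_measurable M" "Y \<in> borel_measurable M"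
  shows "ae_le M (ae_class M X) (ae_class M Y) \<longleftrightarrow> (AE w in M. X w \<le> Y w)"
proof
  assume "ae_le M (ae_class M X) (ae_class M Y)"
  then show "AE w in M. X w \<le> Y w"
    using assms by (auto simp: ae_le_def ae_eq_def)
next
  assume le: "AE w in M. X w \<le> Y w"
  show "ae_le M (ae_class M X) (ae_class M Y)"
    unfolding ae_le_def
  proof (intro ballI)
    fix U V assume "U \<in> ae_class M X" "V \<in> ae_class M Y"
    then have "AE w in M. X w = U w" "AE w in M. Y w = V w"
      by (auto simp: ae_eq_def)
    with le show "AE w in M. U w \<le> V w"
      by eventually_elim simp
  qed
qed

section \<open>Lebesgue spaces and their conditional versions\<close>

definition Lp :: "'a measure \<Rightarrow> 'a measure \<Rightarrow> real \<Rightarrow> ('a \<Rightarrow> real) set set" where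
  "Lp M F p = {x \<in> L0 M F. \<forall>X\<in>x. integrable M (\<lambda>w. \<bar>X w\<bar> powr p)}"

text \<open>\<open>E[|X|\<^sup>p|F]\<^bsup>1/p\<^esup>\<close> as a function with values in \<open>[0,\<infinity>]\<close>; the library has no real power
  function on extended nonnegative reals.\<close>

definition cond_norm :: "'a measure \<Rightarrow> 'a measure \<Rightarrow> real \<Rightarrow> ('a \<Rightarrow> real) \<Rightarrow> 'a \<Rightarrow> ennreal" where
  "cond_norm M F p X w =
    (let c = nn_cond_exp M F (\<lambda>v. ennreal (\<bar>X v\<bar> powr p)) w
     in if c = \<infinity> then \<infinity> else ennreal (enn2real c powr (1 / p)))"

definition Lp_cond :: "'a measure \<Rightarrow> 'a measure \<Rightarrow> real \<Rightarrow> ('a \<Rightarrow> real) set set" where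
  "Lp_cond M F p = {x \<in> L0 M M. \<exists>\<xi>\<in>L0_plus M F.
     \<forall>X\<in>x. \<forall>Z\<in>\<xi>. AE w in M. cond_norm M F p X w = ennreal (Z w)}"

section \<open>Conditional risk measures\<close>

definition Lp_cond_risk_measure ::
  "'a measure \<Rightarrow> 'a measure \<Rightarrow> real \<Rightarrow> real \<Rightarrow> (('a \<Rightarrow> real) set \<Rightarrow> ('a \<Rightarrow> real) set) \<Rightarrow> bool" where
  "Lp_cond_risk_measure M F p r f \<longleftrightarrow>
     f \<in> Lp M M p \<rightarrow> Lp M F r \<and>
     (\<forall>x\<in>Lp M M p. \<forall>y\<in>Lp M M p. ae_le M y x \<longrightarrow> ae_le M (f x) (f y)) \<and>
     (\<forall>x\<in>Lp M M p. \<forall>y\<in>Lp M F p. f (ae_plus M x y) = ae_minus M (f x) y)"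

definition LpF_cond_risk_measure ::
  "'a measure \<Rightarrow> 'a measure \<Rightarrow> real \<Rightarrow> (('a \<Rightarrow> real) set \<Rightarrow> ('a \<Rightarrow> real) set) \<Rightarrow> bool" where
  "LpF_cond_risk_measure M F p f \<longleftrightarrow>
     f \<in> Lp_cond M F p \<rightarrow> L0 M F \<and>
     (\<forall>x\<in>Lp_cond M F p. \<forall>y\<in>Lp_cond M F p. ae_le M y x \<longrightarrow> ae_le M (f x) (f y)) \<and>
     (\<forall>x\<in>Lp_cond M F p. \<forall>y\<in>L0 M F. f (ae_plus M x y) = ae_minus M (f x) y)"

definition L0_convex_on ::
  "'a measure \<Rightarrow> 'a measure \<Rightarrow> ('a \<Rightarrow> real) set set \<Rightarrow> (('a \<Rightarrow> real) set \<Rightarrow> ('a \<Rightarrow> real) set) \<Rightarrow> bool" where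
  "L0_convex_on M F D f \<longleftrightarrow>
     (\<forall>x\<in>D. \<forall>y\<in>D. \<forall>\<xi>\<in>L0_plus M F. ae_le M \<xi> (ae_one M) \<longrightarrow>
        ae_le M
          (f (ae_plus M (ae_times M \<xi> x) (ae_times M (ae_minus M (ae_one M) \<xi>) y)))
          (ae_plus M (ae_times M \<xi> (f x)) (ae_times M (ae_minus M (ae_one M) \<xi>) (f y))))"

end

theory Submission
  imports Defs
begin

text \<open>Testing convexity with indicators of sets \<open>A \<in> F\<close> shows that a conditional risk measure
  is local: its value on \<open>A\<close> depends only on the restriction of the argument to \<open>A\<close>. If
  \<open>E[|X|\<^sup>p|F]\<close> is finite, then the sets \<open>{E[|X|\<^sup>p|F] \<le> n} \<in> F\<close> exhaust the space and \<open>X\<close> is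
  \<open>p\<close>-integrable on each of them. Hence an extension of \<open>f\<close> is determined by \<open>f\<close> on these sets,
  and conversely the values of \<open>f\<close> on the truncated functions glue to an extension; each of its
  properties can be checked on a common exhausting sequence.\<close>

section \<open>Classes and representatives\<close>

lemma ae_class_eq_iff:
  assumes "X \<in> borel_measurable M" "Y \<in> borel_measurable M"
  shows "ae_class M X = ae_class M Y \<longleftrightarrow> (AE w in M. X w = Y w)"
  using eq_equiv_class_iff[OF equiv_ae_eq assms] assms by (simp add: ae_eq_def)

lemma ae_arith_class:
  assumes "X \<in> borel_measurable M" "Y \<in> borel_measurable M"
  shows "ae_plus M (ae_class M X) (ae_class M Y) = ae_class M (\<lambda>w. X w + Y w)"
    and "ae_minus M (ae_class M X) (ae_class M Y) = ae_class M (\<lambda>w. X w - Y w)"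
    and "ae_times M (ae_class M X) (ae_class M Y) = ae_class M (\<lambda>w. X w * Y w)"
  using assms by (simp_all add: lift2_ae_class)

lemma L0_iff: "x \<in> L0 M F \<longleftrightarrow> (\<exists>X\<in>borel_measurable F. x = ae_class M X)"
  by (auto simp: L0_def quotient_def)

definition restrict_to :: "'a set \<Rightarrow> ('a \<Rightarrow> real) \<Rightarrow> 'a \<Rightarrow> real" where
  "restrict_to A X w = indicator A w * X w"

lemma restrict_to_measurable [measurable]:
  assumes [measurable]: "A \<in> sets M" "X \<in> borel_measurable M"
  shows "restrict_to A X \<in> borel_measurable M"
  unfolding restrict_to_def by measurable

section \<open>p-integrable functions and domination\<close>

definition Lp_fun :: "'a measure \<Rightarrow> real \<Rightarrow> ('a \<Rightarrow> real) set" where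
  "Lp_fun M p = {X \<in> borel_measurable M. integrable M (\<lambda>w. \<bar>X w\<bar> powr p)}"

definition LpF_fun :: "'a measure \<Rightarrow> 'a measure \<Rightarrow> real \<Rightarrow> ('a \<Rightarrow> real) set" where
  "LpF_fun M F p = {X \<in> borel_measurable M.
     AE w in M. nn_cond_exp M F (\<lambda>v. ennreal (\<bar>X v\<bar> powr p)) w < \<infinity>}"

lemma Lp_fun_measurable: "X \<in> Lp_fun M p \<Longrightarrow> X \<in> borel_measurable M"
  by (simp add: Lp_fun_def)

lemma LpF_fun_measurable: "X \<in> LpF_fun M F p \<Longrightarrow> X \<in> borel_measurable M"
  by (simp add: LpF_fun_def)

text \<open>The p-th power of a maximum is one of the two p-th powers, hence at most their sum. A
  bound by a maximum suits all closure properties below: convex combinations lie under the maximum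
  of the two functions, sums under the maximum of their doubles.\<close>

lemma Lp_fun_dominated:
  assumes X: "X \<in> borel_measurable M" and Y: "Y \<in> Lp_fun M p" and Z: "Z \<in> Lp_fun M p"
    and le: "AE w in M. \<bar>X w\<bar> \<le> max \<bar>Y w\<bar> \<bar>Z w\<bar>" and p: "0 \<le> p"
  shows "X \<in> Lp_fun M p"
proof -
  have "integrable M (\<lambda>w. \<bar>Y w\<bar> powr p + \<bar>Z w\<bar> powr p)"
    using Y Z by (auto simp: Lp_fun_def)
  moreover have "AE w in M. norm (\<bar>X w\<bar> powr p) \<le> norm (\<bar>Y w\<bar> powr p + \<bar>Z w\<bar> powr p)"
    using le
  proof eventually_elim
    case (elim w)
    have "\<bar>X w\<bar> powr p \<le> (max \<bar>Y w\<bar> \<bar>Z w\<bar>) powr p"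
      using elim p by (intro powr_mono2) auto
    also have "\<dots> \<le> \<bar>Y w\<bar> powr p + \<bar>Z w\<bar> powr p"
      by (auto simp: max_def)
    finally show ?case by simp
  qed
  moreover have "(\<lambda>w. \<bar>X w\<bar> powr p) \<in> borel_measurable M"
    using X by measurable
  ultimately have "integrable M (\<lambda>w. \<bar>X w\<bar> powr p)"
    using Bochner_Integration.integrable_bound by blast
  with X show ?thesis by (simp add: Lp_fun_def)
qed

lemma Lp_fun_restrict_to:
  assumes X: "X \<in> Lp_fun M p" and A: "A \<in> sets M" and p: "0 \<le> p"
  shows "restrict_to A X \<in> Lp_fun M p"
proof (rule Lp_fun_dominated[OF _ X X _ p])
  show "restrict_to A X \<in> borel_measurable M"
    using A Lp_fun_measurable[OF X] by (rule restrict_to_measurable)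
  show "AE w in M. \<bar>restrict_to A X w\<bar> \<le> max \<bar>X w\<bar> \<bar>X w\<bar>"
    by (rule AE_I2) (simp add: restrict_to_def split: split_indicator)
qed

lemma Lp_fun_scale: "X \<in> Lp_fun M p \<Longrightarrow> (\<lambda>w. c * X w) \<in> Lp_fun M p"
  by (auto simp: Lp_fun_def abs_mult powr_mult)

lemma Lp_fun_add:
  assumes X: "X \<in> Lp_fun M p" and Y: "Y \<in> Lp_fun M p" and p: "0 \<le> p"
  shows "(\<lambda>w. X w + Y w) \<in> Lp_fun M p"
  using Lp_fun_measurable[OF X] Lp_fun_measurable[OF Y] p
  by (intro Lp_fun_dominated[OF _ Lp_fun_scale[OF X, of 2] Lp_fun_scale[OF Y, of 2]])
     (auto intro!: AE_I2)

lemma Lp_fun_convex_combination: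
  assumes X: "X \<in> Lp_fun M p" and Y: "Y \<in> Lp_fun M p" and p: "0 \<le> p"
    and t: "t \<in> borel_measurable M" and t01: "AE w in M. 0 \<le> t w \<and> t w \<le> 1"
  shows "(\<lambda>w. t w * X w + (1 - t w) * Y w) \<in> Lp_fun M p"
proof (rule Lp_fun_dominated[OF _ X Y _ p])
  show "(\<lambda>w. t w * X w + (1 - t w) * Y w) \<in> borel_measurable M"
    using Lp_fun_measurable[OF X] Lp_fun_measurable[OF Y] t by measurable
  show "AE w in M. \<bar>t w * X w + (1 - t w) * Y w\<bar> \<le> max \<bar>X w\<bar> \<bar>Y w\<bar>"
    using t01
  proof eventually_elim
    case (elim w)
    have "\<bar>t w * X w + (1 - t w) * Y w\<bar> \<le> t w * \<bar>X w\<bar> + (1 - t w) * \<bar>Y w\<bar>"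
      using elim by (intro order_trans[OF abs_triangle_ineq]) (simp add: abs_mult)
    also have "\<dots> \<le> t w * max \<bar>X w\<bar> \<bar>Y w\<bar> + (1 - t w) * max \<bar>X w\<bar> \<bar>Y w\<bar>"
      using elim by (intro add_mono mult_left_mono) auto
    finally show ?case by (simp add: algebra_simps)
  qed
qed

section \<open>The setting of a sub-sigma-algebra\<close>

locale prob_subalgebra = prob_space M for M :: "'a measure" +
  fixes F :: "'a measure" and p :: real
  assumes subalg_F: "subalgebra M F" and p_pos: "0 < p"

text \<open>A probability measure stays finite on the subalgebra, which puts the theory of
  \<open>nn_cond_exp\<close> at disposal.\<close>

sublocale prob_subalgebra \<subseteq> finite_measure_subalgebra M F
  by unfold_locales (rule subalg_F)

context prob_subalgebra
begin

lemma F_measurable: "X \<in> borel_measurable F \<Longrightarrow> X \<in> borel_measurable M"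
  using measurable_from_subalg[OF subalg_F] .

lemma F_sets: "A \<in> sets F \<Longrightarrow> A \<in> sets M"
  using subalg_F by (auto simp: subalgebra_def)

lemma p_nonneg: "0 \<le> p"
  using p_pos by simp

text \<open>Integrability survives changes on null sets, so a single \<open>G\<close>-measurable
  member decides for the whole class, whose other members need only be
  \<open>M\<close>-measurable.\<close>

lemma Lp_iff:
  assumes "subalgebra M G"
  shows "x \<in> Lp M G q \<longleftrightarrow> (\<exists>X\<in>borel_measurable G. X \<in> Lp_fun M q \<and> x = ae_class M X)"
proof
  assume "x \<in> Lp M G q"
  then obtain X where X: "X \<in> borel_measurable G" "x = ae_class M X"
    and int: "\<And>X. X \<in> x \<Longrightarrow> integrable M (\<lambda>w. \<bar>X w\<bar> powr q)"
    by (auto simp: Lp_def L0_iff)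
  have "X \<in> borel_measurable M"
    using measurable_from_subalg[OF assms X(1)] .
  moreover from this have "X \<in> x"
    by (simp add: X(2) ae_eq_def)
  ultimately show "\<exists>X\<in>borel_measurable G. X \<in> Lp_fun M q \<and> x = ae_class M X"
    using X int by (auto simp: Lp_fun_def)
next
  assume "\<exists>X\<in>borel_measurable G. X \<in> Lp_fun M q \<and> x = ae_class M X"
  then obtain X where X: "X \<in> borel_measurable G" "X \<in> Lp_fun M q" "x = ae_class M X"
    by blast
  have "integrable M (\<lambda>w. \<bar>Y w\<bar> powr q)" if "Y \<in> x" for Y
  proof (rule integrable_cong_AE_imp)
    show "integrable M (\<lambda>w. \<bar>X w\<bar> powr q)"
      using X(2) by (simp add: Lp_fun_def)
    have Y: "Y \<in> borel_measurable M" "AE w in M. X w = Y w"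
      using that by (auto simp: X(3) ae_eq_def)
    show "(\<lambda>w. \<bar>Y w\<bar> powr q) \<in> borel_measurable M"
      using Y(1) by measurable
    show "AE w in M. \<bar>X w\<bar> powr q = \<bar>Y w\<bar> powr q"
      using Y(2) by eventually_elim simp
  qed
  then show "x \<in> Lp M G q"
    using X by (auto simp: Lp_def L0_iff)
qed

lemma subalgebra_refl: "subalgebra M M"
  by (simp add: subalgebra_def)

lemma Lp_eq_image: "Lp M M q = ae_class M ` Lp_fun M q"
proof (intro set_eqI iffI)
  fix x assume "x \<in> ae_class M ` Lp_fun M q"
  then obtain X where "X \<in> Lp_fun M q" "x = ae_class M X" by blast
  then show "x \<in> Lp M M q"
    unfolding Lp_iff[OF subalgebra_refl] by (intro bexI[of _ X]) (simp_all add: Lp_fun_measurable)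
qed (auto simp only: Lp_iff[OF subalgebra_refl])

text \<open>A value \<open>ennreal (Z w)\<close> is never infinite, which forces the conditional
  moment to be finite. Conversely, the root of a finite moment is a nonnegative
  \<open>F\<close>-measurable function, and it does not depend on the representative up to null
  sets.\<close>

lemma Lp_cond_eq_image: "Lp_cond M F p = ae_class M ` LpF_fun M F p"
proof (intro set_eqI iffI)
  fix x assume "x \<in> Lp_cond M F p"
  then obtain X \<xi> where X: "X \<in> borel_measurable M" "x = ae_class M X" and \<xi>: "\<xi> \<in> L0_plus M F"
    and eq: "\<And>X Z. X \<in> x \<Longrightarrow> Z \<in> \<xi> \<Longrightarrow> AE w in M. cond_norm M F p X w = ennreal (Z w)"
    unfolding Lp_cond_def by (auto simp: L0_iff)
  obtain Z where Z: "Z \<in> borel_measurable F" "\<xi> = ae_class M Z"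
    using \<xi> by (auto simp: L0_plus_def L0_iff)
  have "AE w in M. cond_norm M F p X w = ennreal (Z w)"
    by (rule eq) (use X Z F_measurable in \<open>auto simp: ae_eq_def\<close>)
  then have "AE w in M. nn_cond_exp M F (\<lambda>v. ennreal (\<bar>X v\<bar> powr p)) w < \<infinity>"
    by eventually_elim (auto simp: cond_norm_def Let_def less_top split: if_splits)
  then show "x \<in> ae_class M ` LpF_fun M F p"
    using X by (auto simp: LpF_fun_def)
next
  fix x assume "x \<in> ae_class M ` LpF_fun M F p"
  then obtain X where X [measurable]: "X \<in> borel_measurable M" and x: "x = ae_class M X"
    and fin: "AE w in M. nn_cond_exp M F (\<lambda>v. ennreal (\<bar>X v\<bar> powr p)) w < \<infinity>"
    by (auto simp: LpF_fun_def)
  define c where "c = nn_cond_exp M F (\<lambda>v. ennreal (\<bar>X v\<bar> powr p))"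
  \<comment> \<open>\<open>enn2real\<close> turns an infinite moment into 0; by \<open>fin\<close>
    this happens only on a null set.\<close>
  define Z where "Z = (\<lambda>w. enn2real (c w) powr (1 / p))"
  have Z: "Z \<in> borel_measurable F"
    unfolding Z_def c_def by measurable
  have "ae_class M Z \<in> L0_plus M F"
    using Z F_measurable[OF Z] by (auto simp: L0_plus_def L0_iff ae_le_ae_class Z_def)
  moreover have "AE w in M. cond_norm M F p Y w = ennreal (V w)"
    if "Y \<in> x" "V \<in> ae_class M Z" for Y V
  proof -
    have Y [measurable]: "Y \<in> borel_measurable M" and XY: "AE w in M. X w = Y w"
      and ZV: "AE w in M. Z w = V w"
      using that by (auto simp: x ae_eq_def)
    have "AE w in M. c w = nn_cond_exp M F (\<lambda>v. ennreal (\<bar>Y v\<bar> powr p)) w"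
      unfolding c_def using XY by (intro nn_cond_exp_cong) auto
    with fin ZV show ?thesis
      unfolding c_def[symmetric]
      by eventually_elim (auto simp: cond_norm_def Z_def Let_def)
  qed
  ultimately show "x \<in> Lp_cond M F p"
    using X unfolding Lp_cond_def x by (auto simp only: L0_iff intro!: bexI[of _ "ae_class M Z"])
qed

section \<open>Exhaustion by sets of integrability\<close>

text \<open>Monotonicity is required so that intersecting two such sequences index by index gives
  another one; covering up to a null set suffices for statements about classes.\<close>

definition exhausts :: "(nat \<Rightarrow> 'a set) \<Rightarrow> bool" where
  "exhausts C \<longleftrightarrow> range C \<subseteq> sets F \<and> incseq C \<and> (AE w in M. \<exists>n. w \<in> C n)"

lemma exhausts_sets: "exhausts C \<Longrightarrow> C n \<in> sets F"
  by (auto simp: exhausts_def)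

lemma exhausts_Int:
  assumes "exhausts C" "exhausts D"
  shows "exhausts (\<lambda>n. C n \<inter> D n)"
proof -
  have inc: "incseq C" "incseq D"
    using assms by (auto simp: exhausts_def)
  have "AE w in M. \<exists>n. w \<in> C n" "AE w in M. \<exists>n. w \<in> D n"
    using assms by (auto simp: exhausts_def)
  then have "AE w in M. \<exists>n. w \<in> C n \<inter> D n"
  proof eventually_elim
    case (elim w)
    then obtain m n where "w \<in> C m" "w \<in> D n" by blast
    then have "w \<in> C (max m n)" "w \<in> D (max m n)"
      using inc by (meson incseqD max.cobounded1 max.cobounded2 subsetD)+
    then show ?case by blast
  qed
  moreover have "incseq (\<lambda>n. C n \<inter> D n)"
    using inc unfolding incseq_def by blast
  ultimately show ?thesis
    using assms by (auto simp: exhausts_def)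
qed

text \<open>Countably many exceptional null sets have a null union. This is how every property of
  the extension is reduced to pieces on which \<open>f\<close> itself is available.\<close>

lemma exhausts_AE:
  assumes "exhausts C" "\<And>n. AE w in M. w \<in> C n \<longrightarrow> P w"
  shows "AE w in M. P w"
proof -
  have "AE w in M. \<forall>n. w \<in> C n \<longrightarrow> P w"
    unfolding AE_all_countable using assms(2) by blast
  moreover have "AE w in M. \<exists>n. w \<in> C n"
    using assms(1) by (simp add: exhausts_def)
  ultimately show ?thesis by eventually_elim blast
qed

lemma exhausts_bounded:
  fixes Y :: "'a \<Rightarrow> real"
  assumes [measurable]: "Y \<in> borel_measurable F"
  shows "exhausts (\<lambda>n. {w \<in> space F. \<bar>Y w\<bar> \<le> real n})"
proof -
  have "space F = space M"
    using subalg_F by (simp add: subalgebra_def)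
  then have "AE w in M. \<exists>n. w \<in> {w \<in> space F. \<bar>Y w\<bar> \<le> real n}"
    by (intro AE_I2) (auto simp: real_arch_simple)
  then show ?thesis
    by (auto simp: exhausts_def incseq_def)
qed

lemma Lp_fun_bounded:
  assumes [measurable]: "X \<in> borel_measurable M" and "\<And>w. \<bar>X w\<bar> \<le> B"
  shows "X \<in> Lp_fun M p"
proof -
  have "integrable M (\<lambda>w. \<bar>X w\<bar> powr p)"
    by (rule integrable_const_bound[of _ "B powr p"])
       (use assms p_nonneg in \<open>auto intro!: powr_mono2\<close>)
  then show ?thesis by (simp add: Lp_fun_def)
qed

text \<open>The defining property of conditional expectation, tested against the indicator of a set
  in \<open>F\<close>. It links integrability on \<open>A\<close> with the conditional
  moment.\<close>

lemma nn_integral_restrict_to: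
  assumes [measurable]: "X \<in> borel_measurable M" and A: "A \<in> sets F"
  shows "(\<integral>\<^sup>+w. ennreal (\<bar>restrict_to A X w\<bar> powr p) \<partial>M) =
    (\<integral>\<^sup>+w. indicator A w * nn_cond_exp M F (\<lambda>v. ennreal (\<bar>X v\<bar> powr p)) w \<partial>M)"
  using A p_pos by (subst nn_cond_exp_intg)
    (auto intro!: nn_integral_cong simp: restrict_to_def split: split_indicator)

lemma restrict_to_Lp_iff:
  assumes "X \<in> borel_measurable M" and A: "A \<in> sets F"
  shows "restrict_to A X \<in> Lp_fun M p \<longleftrightarrow>
    (\<integral>\<^sup>+w. indicator A w * nn_cond_exp M F (\<lambda>v. ennreal (\<bar>X v\<bar> powr p)) w \<partial>M) < \<infinity>"
  using restrict_to_measurable[OF F_sets[OF A] assms(1)]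
  by (simp add: Lp_fun_def integrable_iff_bounded nn_integral_restrict_to[OF assms, symmetric])

text \<open>Cut at the levels of the conditional moment: where it is at most \<open>n\<close>, its
  integral is at most \<open>n\<close> because the total mass is 1.\<close>

lemma LpF_fun_exhaust:
  assumes "X \<in> LpF_fun M F p"
  shows "\<exists>C. exhausts C \<and> (\<forall>n. restrict_to (C n) X \<in> Lp_fun M p)"
proof -
  have X: "X \<in> borel_measurable M"
    using assms by (rule LpF_fun_measurable)
  define c where "c = nn_cond_exp M F (\<lambda>v. ennreal (\<bar>X v\<bar> powr p))"
  have [measurable]: "c \<in> borel_measurable F"
    unfolding c_def by measurable
  define C where "C n = {w \<in> space F. c w \<le> of_nat n}" for n
  have sets: "C n \<in> sets F" for n
    unfolding C_def by measurable
  have spc: "space F = space M"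
    using subalg_F by (simp add: subalgebra_def)
  have "AE w in M. c w < \<infinity>"
    using assms by (simp add: LpF_fun_def c_def)
  then have "AE w in M. \<exists>n. w \<in> C n"
    using AE_space
  proof eventually_elim
    case (elim w)
    then obtain n where "c w < of_nat n"
      using ennreal_Ex_less_of_nat[of "c w"] by auto
    with elim show ?case by (auto simp: C_def spc intro!: exI[of _ n] less_imp_le)
  qed
  moreover have "incseq C"
  proof (rule incseq_SucI, rule subsetI)
    fix n w assume "w \<in> C n"
    moreover have "(of_nat n :: ennreal) \<le> of_nat (Suc n)"
      by (rule of_nat_mono) simp
    ultimately show "w \<in> C (Suc n)"
      unfolding C_def by (auto intro: order_trans)
  qed
  ultimately have "exhausts C"
    using sets by (auto simp: exhausts_def)
  moreover have "restrict_to (C n) X \<in> Lp_fun M p" for n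
  proof -
    have "(\<integral>\<^sup>+w. indicator (C n) w * c w \<partial>M) \<le> (\<integral>\<^sup>+w. of_nat n \<partial>M)"
      by (rule nn_integral_mono) (auto simp: C_def split: split_indicator)
    also have "\<dots> < \<infinity>"
      by (simp add: emeasure_space_1 of_nat_less_top)
    finally show ?thesis
      unfolding restrict_to_Lp_iff[OF X sets] c_def .
  qed
  ultimately show ?thesis by blast
qed

text \<open>A finite integral over \<open>C n\<close> makes the conditional moment finite a.e. on
  \<open>C n\<close>. Together with \<open>LpF_fun_exhaust\<close> this describes
  \<open>LpF_fun\<close> by p-integrability along some exhausting sequence, so later membership
  proofs need no inequalities for conditional expectations.\<close>

lemma LpF_funI:
  assumes X: "X \<in> borel_measurable M"
    and C: "exhausts C" "\<And>n. restrict_to (C n) X \<in> Lp_fun M p"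
  shows "X \<in> LpF_fun M F p"
proof -
  define c where "c = nn_cond_exp M F (\<lambda>v. ennreal (\<bar>X v\<bar> powr p))"
  have [measurable]: "c \<in> borel_measurable M"
    unfolding c_def by measurable
  have [measurable]: "C n \<in> sets M" for n
    using F_sets exhausts_sets[OF C(1)] by blast
  have "AE w in M. c w < \<infinity>"
  proof (rule exhausts_AE[OF C(1)])
    fix n
    have "(\<integral>\<^sup>+w. indicator (C n) w * c w \<partial>M) < \<infinity>"
      using C(2)[of n] unfolding restrict_to_Lp_iff[OF X exhausts_sets[OF C(1)]] c_def .
    then have "AE w in M. indicator (C n) w * c w \<noteq> \<infinity>"
      by (intro nn_integral_PInf_AE) auto
    then show "AE w in M. w \<in> C n \<longrightarrow> c w < \<infinity>"
      by eventually_elim (auto simp: less_top split: split_indicator)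
  qed
  then show ?thesis using X by (simp add: LpF_fun_def c_def)
qed

lemma LpF_fun_exhaust2:
  assumes "X \<in> LpF_fun M F p" "Y \<in> LpF_fun M F p"
  shows "\<exists>C. exhausts C \<and> (\<forall>n. restrict_to (C n) X \<in> Lp_fun M p \<and> restrict_to (C n) Y \<in> Lp_fun M p)"
proof -
  obtain C where C: "exhausts C" "\<And>n. restrict_to (C n) X \<in> Lp_fun M p"
    using LpF_fun_exhaust[OF assms(1)] by blast
  obtain D where D: "exhausts D" "\<And>n. restrict_to (D n) Y \<in> Lp_fun M p"
    using LpF_fun_exhaust[OF assms(2)] by blast
  \<comment> \<open>The order of the two restrictions differs, so that each time a function already
    known to be p-integrable is cut down further.\<close>
  have "restrict_to (C n \<inter> D n) X = restrict_to (D n) (restrict_to (C n) X)"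
    "restrict_to (C n \<inter> D n) Y = restrict_to (C n) (restrict_to (D n) Y)" for n
    by (auto simp: restrict_to_def fun_eq_iff split: split_indicator)
  moreover have "restrict_to (D n) (restrict_to (C n) X) \<in> Lp_fun M p"
    "restrict_to (C n) (restrict_to (D n) Y) \<in> Lp_fun M p" for n
    using Lp_fun_restrict_to[OF C(2) F_sets[OF exhausts_sets[OF D(1)]] p_nonneg]
      Lp_fun_restrict_to[OF D(2) F_sets[OF exhausts_sets[OF C(1)]] p_nonneg] by blast+
  ultimately show ?thesis
    using exhausts_Int[OF C(1) D(1)] by (intro exI[of _ "\<lambda>n. C n \<inter> D n"]) simp
qed

lemma Lp_fun_imp_LpF_fun:
  assumes "X \<in> Lp_fun M p"
  shows "X \<in> LpF_fun M F p"
\<comment> \<open>For the zero function the sets of \<open>exhausts_bounded\<close> are all equal to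
  \<open>space F\<close>, which gives a constant sequence.\<close>
proof (rule LpF_funI[OF Lp_fun_measurable[OF assms] exhausts_bounded[of "\<lambda>_. 0"]])
  show "restrict_to {w \<in> space F. \<bar>0 :: real\<bar> \<le> real n} X \<in> Lp_fun M p" for n
    using F_sets by (intro Lp_fun_restrict_to[OF assms _ p_nonneg]) auto
qed simp

text \<open>An \<open>F\<close>-measurable function need not be integrable, but the sets where it is
  bounded by \<open>n\<close> lie in \<open>F\<close> and exhaust the space. Hence translations by
  arbitrary elements of \<open>L0 M F\<close> stay inside the domain of the extension.\<close>

lemma F_measurable_imp_LpF_fun:
  assumes "Y \<in> borel_measurable F"
  shows "Y \<in> LpF_fun M F p"
proof (rule LpF_funI[OF F_measurable[OF assms] exhausts_bounded[OF assms]])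
  fix n
  have "{w \<in> space F. \<bar>Y w\<bar> \<le> real n} \<in> sets M"
    using exhausts_sets[OF exhausts_bounded[OF assms]] by (rule F_sets)
  then show "restrict_to {w \<in> space F. \<bar>Y w\<bar> \<le> real n} Y \<in> Lp_fun M p"
    using F_measurable[OF assms]
    by (intro Lp_fun_bounded[where B = "real n"] restrict_to_measurable)
       (auto simp: restrict_to_def split: split_indicator)
qed

section \<open>Closure of the conditional space under sums and convex combinations\<close>

lemma LpF_fun_add:
  assumes X: "X \<in> LpF_fun M F p" and Y: "Y \<in> LpF_fun M F p"
  shows "(\<lambda>w. X w + Y w) \<in> LpF_fun M F p"
proof -
  obtain C where C: "exhausts C" "\<And>n. restrict_to (C n) X \<in> Lp_fun M p"
    "\<And>n. restrict_to (C n) Y \<in> Lp_fun M p"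
    using LpF_fun_exhaust2[OF X Y] by blast
  have "restrict_to A (\<lambda>w. X w + Y w) = (\<lambda>w. restrict_to A X w + restrict_to A Y w)" for A
    by (auto simp: restrict_to_def algebra_simps)
  moreover have "(\<lambda>w. X w + Y w) \<in> borel_measurable M"
    using LpF_fun_measurable[OF X] LpF_fun_measurable[OF Y] by measurable
  ultimately show ?thesis
    using Lp_fun_add[OF C(2,3) p_nonneg] by (intro LpF_funI[OF _ C(1)]) simp_all
qed

lemma restrict_to_convex_combination:
  "restrict_to A (\<lambda>w. t w * X w + (1 - t w) * Y w) =
    (\<lambda>w. t w * restrict_to A X w + (1 - t w) * restrict_to A Y w)"
  by (auto simp: restrict_to_def algebra_simps)

lemma LpF_fun_convex_combination:
  assumes X: "X \<in> LpF_fun M F p" and Y: "Y \<in> LpF_fun M F p"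
    and t: "t \<in> borel_measurable M" and t01: "AE w in M. 0 \<le> t w \<and> t w \<le> 1"
  shows "(\<lambda>w. t w * X w + (1 - t w) * Y w) \<in> LpF_fun M F p"
proof -
  obtain C where C: "exhausts C" "\<And>n. restrict_to (C n) X \<in> Lp_fun M p"
    "\<And>n. restrict_to (C n) Y \<in> Lp_fun M p"
    using LpF_fun_exhaust2[OF X Y] by blast
  show ?thesis
  proof (rule LpF_funI[OF _ C(1)])
    show "(\<lambda>w. t w * X w + (1 - t w) * Y w) \<in> borel_measurable M"
      using LpF_fun_measurable[OF X] LpF_fun_measurable[OF Y] t by measurable
    show "restrict_to (C n) (\<lambda>w. t w * X w + (1 - t w) * Y w) \<in> Lp_fun M p" for n
      unfolding restrict_to_convex_combination
      by (rule Lp_fun_convex_combination[OF C(2,3) p_nonneg t t01])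
  qed
qed

section \<open>Locality\<close>

text \<open>Choosing an \<open>F\<close>-measurable member of the value turns statements about
  classes into a.e. statements about real functions. The map \<open>g\<close> is a parameter because
  both \<open>f\<close> and its candidate extensions are treated.\<close>

definition rep :: "(('a \<Rightarrow> real) set \<Rightarrow> ('a \<Rightarrow> real) set) \<Rightarrow> ('a \<Rightarrow> real) \<Rightarrow> 'a \<Rightarrow> real" where
  "rep g X = (SOME Z. Z \<in> borel_measurable F \<and> g (ae_class M X) = ae_class M Z)"

lemma rep:
  assumes "g (ae_class M X) \<in> L0 M F"
  shows "rep g X \<in> borel_measurable F" "g (ae_class M X) = ae_class M (rep g X)"
proof -
  have "\<exists>Z. Z \<in> borel_measurable F \<and> g (ae_class M X) = ae_class M Z"
    using assms by (auto simp: L0_iff)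
  from someI_ex[OF this]
  show "rep g X \<in> borel_measurable F" "g (ae_class M X) = ae_class M (rep g X)"
    by (simp_all add: rep_def)
qed

text \<open>The choice sees \<open>X\<close> only through its class, so the chosen functions are
  equal everywhere and not merely a.e.\<close>

lemma rep_cong:
  assumes "X \<in> borel_measurable M" "Y \<in> borel_measurable M" "AE w in M. X w = Y w"
  shows "rep g X = rep g Y"
  unfolding rep_def using assms by (simp add: ae_class_eq_iff[THEN iffD2, OF assms])

lemma ae_convex_class:
  assumes "t \<in> borel_measurable M" "X \<in> borel_measurable M" "Y \<in> borel_measurable M"
  shows "ae_plus M (ae_times M (ae_class M t) (ae_class M X))
      (ae_times M (ae_minus M (ae_one M) (ae_class M t)) (ae_class M Y)) =
    ae_class M (\<lambda>w. t w * X w + (1 - t w) * Y w)"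
proof -
  note [measurable] = assms
  have "ae_minus M (ae_one M) (ae_class M t) = ae_class M (\<lambda>w. 1 - t w)"
    by (rule ae_arith_class(2)) measurable
  moreover have "ae_times M (ae_class M t) (ae_class M X) = ae_class M (\<lambda>w. t w * X w)"
    by (rule ae_arith_class(3)) measurable
  moreover have "ae_times M (ae_class M (\<lambda>w. 1 - t w)) (ae_class M Y) = ae_class M (\<lambda>w. (1 - t w) * Y w)"
    by (rule ae_arith_class(3)) measurable
  moreover have "ae_plus M (ae_class M (\<lambda>w. t w * X w)) (ae_class M (\<lambda>w. (1 - t w) * Y w)) =
      ae_class M (\<lambda>w. t w * X w + (1 - t w) * Y w)"
    by (rule ae_arith_class(1)) measurable
  ultimately show ?thesis by simp
qed

text \<open>The domain \<open>D\<close> is left open so that the result, and locality with it,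
  applies to \<open>Lp_fun\<close> as well as to \<open>LpF_fun\<close>.\<close>

lemma convex_rep:
  assumes D: "D \<subseteq> borel_measurable M" and g: "g \<in> ae_class M ` D \<rightarrow> L0 M F"
    and conv: "L0_convex_on M F (ae_class M ` D) g"
    and X: "X \<in> D" and Y: "Y \<in> D" and t: "t \<in> borel_measurable F"
    and t01: "AE w in M. 0 \<le> t w \<and> t w \<le> 1"
    and comb: "(\<lambda>w. t w * X w + (1 - t w) * Y w) \<in> D"
  shows "AE w in M. rep g (\<lambda>w. t w * X w + (1 - t w) * Y w) w \<le>
    t w * rep g X w + (1 - t w) * rep g Y w"
proof -
  let ?Z = "\<lambda>w. t w * X w + (1 - t w) * Y w"
  have L0: "g (ae_class M V) \<in> L0 M F" if "V \<in> D" for V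
    using g that by blast
  have r: "rep g V \<in> borel_measurable F" "g (ae_class M V) = ae_class M (rep g V)" if "V \<in> D" for V
    using rep[where g = g and X = V, OF L0[OF that]] .
  have tM: "t \<in> borel_measurable M"
    using F_measurable t .
  have XY: "X \<in> borel_measurable M" "Y \<in> borel_measurable M"
    using D X Y by auto
  have rM: "rep g V \<in> borel_measurable M" if "V \<in> D" for V
    using F_measurable r(1) that by blast
  have "ae_class M t \<in> L0_plus M F" "ae_le M (ae_class M t) (ae_one M)"
    using t tM t01 by (auto simp: L0_plus_def L0_iff ae_le_ae_class)
  then have "ae_le M (g (ae_class M ?Z))
      (ae_plus M (ae_times M (ae_class M t) (g (ae_class M X)))
        (ae_times M (ae_minus M (ae_one M) (ae_class M t)) (g (ae_class M Y))))"
    using conv X Y unfolding L0_convex_on_def ae_convex_class[OF tM XY, symmetric] by blast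
  then have "ae_le M (ae_class M (rep g ?Z))
      (ae_class M (\<lambda>w. t w * rep g X w + (1 - t w) * rep g Y w))"
    unfolding r(2)[OF comb] r(2)[OF X] r(2)[OF Y] ae_convex_class[OF tM rM[OF X] rM[OF Y]] .
  moreover have "(\<lambda>w. t w * rep g X w + (1 - t w) * rep g Y w) \<in> borel_measurable M"
    using tM rM[OF X] rM[OF Y] by measurable
  ultimately show ?thesis
    using rM[OF comb] by (simp only: ae_le_ae_class)
qed

text \<open>Convexity with the weight \<open>indicator A\<close>: a function agreeing with \<open>Y\<close> on \<open>A\<close> is the
  combination of \<open>Y\<close> (on \<open>A\<close>) and of itself (off \<open>A\<close>).\<close>

lemma locality_le:
  assumes D: "D \<subseteq> borel_measurable M" and g: "g \<in> ae_class M ` D \<rightarrow> L0 M F"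
    and conv: "L0_convex_on M F (ae_class M ` D) g"
    and closed: "\<And>X Y A. X \<in> D \<Longrightarrow> Y \<in> D \<Longrightarrow> A \<in> sets F \<Longrightarrow>
      (\<lambda>w. indicator A w * X w + (1 - indicator A w) * Y w) \<in> D"
    and X: "X \<in> D" and Y: "Y \<in> D" and A: "A \<in> sets F"
    and eq: "AE w in M. w \<in> A \<longrightarrow> X w = Y w"
  shows "AE w in M. w \<in> A \<longrightarrow> rep g X w \<le> rep g Y w"
proof -
  let ?Z = "\<lambda>w. indicator A w * Y w + (1 - indicator A w) * X w"
  have Z: "?Z \<in> D"
    using closed[OF Y X A] .
  have "AE w in M. X w = ?Z w"
    using eq by eventually_elim (auto split: split_indicator)
  then have rep_eq: "rep g ?Z = rep g X"
    using D X Z by (intro rep_cong[symmetric]) auto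
  have "AE w in M. rep g ?Z w \<le> indicator A w * rep g Y w + (1 - indicator A w) * rep g X w"
    using A by (intro convex_rep[OF D g conv Y X _ _ Z] borel_measurable_indicator AE_I2)
      (auto split: split_indicator)
  \<comment> \<open>Off \<open>A\<close> both sides are \<open>rep g X\<close>; on \<open>A\<close>
    the right side is \<open>rep g Y\<close>.\<close>
  then show ?thesis
    unfolding rep_eq by eventually_elim (auto split: split_indicator)
qed

text \<open>The hypothesis on \<open>X\<close> and \<open>Y\<close> is symmetric, so the inequality
  holds in both directions.\<close>

lemma locality:
  assumes D: "D \<subseteq> borel_measurable M" and g: "g \<in> ae_class M ` D \<rightarrow> L0 M F"
    and conv: "L0_convex_on M F (ae_class M ` D) g"
    and closed: "\<And>X Y A. X \<in> D \<Longrightarrow> Y \<in> D \<Longrightarrow> A \<in> sets F \<Longrightarrow>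
      (\<lambda>w. indicator A w * X w + (1 - indicator A w) * Y w) \<in> D"
    and X: "X \<in> D" and Y: "Y \<in> D" and A: "A \<in> sets F"
    and eq: "AE w in M. w \<in> A \<longrightarrow> X w = Y w"
  shows "AE w in M. w \<in> A \<longrightarrow> rep g X w = rep g Y w"
proof -
  have eq': "AE w in M. w \<in> A \<longrightarrow> Y w = X w"
    using eq by eventually_elim simp
  have "AE w in M. w \<in> A \<longrightarrow> rep g X w \<le> rep g Y w"
    by (rule locality_le[OF D g conv _ X Y A eq]) (rule closed)
  moreover have "AE w in M. w \<in> A \<longrightarrow> rep g Y w \<le> rep g X w"
    by (rule locality_le[OF D g conv _ Y X A eq']) (rule closed)
  ultimately show ?thesis
    by eventually_elim auto
qed

lemma indicator_weight:
  assumes "A \<in> sets F"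
  shows "(indicator A :: 'a \<Rightarrow> real) \<in> borel_measurable M"
    "AE w in M. 0 \<le> (indicator A w :: real) \<and> indicator A w \<le> (1 :: real)"
  using F_sets[OF assms] by (auto split: split_indicator)

lemma Lp_locality:
  assumes f: "f \<in> Lp M M p \<rightarrow> L0 M F" and conv: "L0_convex_on M F (Lp M M p) f"
    and "X \<in> Lp_fun M p" "Y \<in> Lp_fun M p" "A \<in> sets F" "AE w in M. w \<in> A \<longrightarrow> X w = Y w"
  shows "AE w in M. w \<in> A \<longrightarrow> rep f X w = rep f Y w"
proof (rule locality[OF _ f[unfolded Lp_eq_image] conv[unfolded Lp_eq_image] _ assms(3-)])
  show "Lp_fun M p \<subseteq> borel_measurable M"
    using Lp_fun_measurable by blast
  show "(\<lambda>w. indicator A w * X w + (1 - indicator A w) * Y w) \<in> Lp_fun M p"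
    if "X \<in> Lp_fun M p" "Y \<in> Lp_fun M p" "A \<in> sets F" for X Y A
    using Lp_fun_convex_combination[OF that(1,2) p_nonneg indicator_weight[OF that(3)]] .
qed

lemma LpF_locality:
  assumes g: "g \<in> Lp_cond M F p \<rightarrow> L0 M F" and conv: "L0_convex_on M F (Lp_cond M F p) g"
    and "X \<in> LpF_fun M F p" "Y \<in> LpF_fun M F p" "A \<in> sets F" "AE w in M. w \<in> A \<longrightarrow> X w = Y w"
  shows "AE w in M. w \<in> A \<longrightarrow> rep g X w = rep g Y w"
proof (rule locality[OF _ g[unfolded Lp_cond_eq_image] conv[unfolded Lp_cond_eq_image] _ assms(3-)])
  show "LpF_fun M F p \<subseteq> borel_measurable M"
    using LpF_fun_measurable by blast
  show "(\<lambda>w. indicator A w * X w + (1 - indicator A w) * Y w) \<in> LpF_fun M F p"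
    if "X \<in> LpF_fun M F p" "Y \<in> LpF_fun M F p" "A \<in> sets F" for X Y A
    using LpF_fun_convex_combination[OF that(1,2) indicator_weight[OF that(3)]] .
qed

end

section \<open>Gluing\<close>

locale convex_risk_measure = prob_subalgebra M F p
  for M F :: "'a measure" and p :: real +
  fixes r :: real and f :: "('a \<Rightarrow> real) set \<Rightarrow> ('a \<Rightarrow> real) set"
  assumes risk: "Lp_cond_risk_measure M F p r f"
    and convex: "L0_convex_on M F (Lp M M p) f"
begin

section \<open>The given risk measure on representatives\<close>

lemma f_L0: "f \<in> Lp M M p \<rightarrow> L0 M F"
  using risk by (auto simp: Lp_cond_risk_measure_def Lp_def Pi_iff)

lemma class_Lp: "X \<in> Lp_fun M p \<Longrightarrow> ae_class M X \<in> Lp M M p"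
  by (simp add: Lp_eq_image)

lemma class_Lp_cond: "X \<in> LpF_fun M F p \<Longrightarrow> ae_class M X \<in> Lp_cond M F p"
  by (simp add: Lp_cond_eq_image)

lemma rep_f:
  assumes "X \<in> Lp_fun M p"
  shows "rep f X \<in> borel_measurable F" "rep f X \<in> borel_measurable M"
    "f (ae_class M X) = ae_class M (rep f X)"
  using rep[where g = f and X = X] F_measurable f_L0 class_Lp[OF assms] by blast+

lemma rep_f_antimono:
  assumes X: "X \<in> Lp_fun M p" and Y: "Y \<in> Lp_fun M p" and le: "AE w in M. Y w \<le> X w"
  shows "AE w in M. rep f X w \<le> rep f Y w"
proof -
  have "ae_le M (ae_class M Y) (ae_class M X)"
    using le X Y by (simp add: ae_le_ae_class Lp_fun_measurable)
  then have "ae_le M (f (ae_class M X)) (f (ae_class M Y))"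
    using risk class_Lp[OF X] class_Lp[OF Y] unfolding Lp_cond_risk_measure_def by blast
  then show ?thesis
    by (simp add: rep_f X Y ae_le_ae_class)
qed

lemma rep_f_translate:
  assumes X: "X \<in> Lp_fun M p" and Y: "Y \<in> Lp_fun M p" and YF: "Y \<in> borel_measurable F"
  shows "AE w in M. rep f (\<lambda>w. X w + Y w) w = rep f X w - Y w"
proof -
  have XY: "(\<lambda>w. X w + Y w) \<in> Lp_fun M p"
    using Lp_fun_add[OF X Y p_nonneg] .
  have "ae_class M Y \<in> Lp M F p"
    unfolding Lp_iff[OF subalg_F] using Y YF by blast
  then have "f (ae_plus M (ae_class M X) (ae_class M Y)) = ae_minus M (f (ae_class M X)) (ae_class M Y)"
    using risk class_Lp[OF X] unfolding Lp_cond_risk_measure_def by blast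
  then have "ae_class M (rep f (\<lambda>w. X w + Y w)) = ae_class M (\<lambda>w. rep f X w - Y w)"
    using Lp_fun_measurable[OF X] Lp_fun_measurable[OF Y]
    by (simp add: ae_arith_class rep_f[OF X] rep_f[OF XY])
  moreover have "(\<lambda>w. rep f X w - Y w) \<in> borel_measurable M"
    using rep_f(2)[OF X] Lp_fun_measurable[OF Y] by measurable
  ultimately show ?thesis
    using rep_f(2)[OF XY] by (simp add: ae_class_eq_iff)
qed

text \<open>All sets of \<open>F\<close> on which \<open>X\<close> becomes p-integrable are tested,
  instead of one chosen exhausting sequence. Hence any sequence may be used later, in particular a
  common one for two functions.\<close>

definition glued :: "('a \<Rightarrow> real) \<Rightarrow> ('a \<Rightarrow> real) \<Rightarrow> bool" where
  "glued X G \<longleftrightarrow> G \<in> borel_measurable F \<and>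
     (\<forall>A\<in>sets F. restrict_to A X \<in> Lp_fun M p \<longrightarrow>
        (AE w in M. w \<in> A \<longrightarrow> G w = rep f (restrict_to A X) w))"

lemma gluedD:
  assumes "glued X G" "A \<in> sets F" "restrict_to A X \<in> Lp_fun M p"
  shows "AE w in M. w \<in> A \<longrightarrow> G w = rep f (restrict_to A X) w"
  using assms by (simp add: glued_def)

lemma glued_measurable:
  assumes "glued X G"
  shows "G \<in> borel_measurable F" "G \<in> borel_measurable M"
  using assms F_measurable by (auto simp: glued_def)

text \<open>On the set of points whose first piece is \<open>C n\<close>, take the value of
  \<open>f\<close> at the truncation to \<open>C n\<close>. By locality another piece, or any
  admissible \<open>A\<close>, gives the same value a.e.\<close>

lemma glued_exists:
  assumes "X \<in> LpF_fun M F p"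
  shows "\<exists>G. glued X G"
proof -
  obtain C where C: "exhausts C" and CX: "\<And>n. restrict_to (C n) X \<in> Lp_fun M p"
    using LpF_fun_exhaust[OF assms] by blast
  have [measurable]: "C n \<in> sets F" for n
    using exhausts_sets[OF C] .
  \<comment> \<open>Points outside every \<open>C n\<close> get an unspecified index, but they form
    a null set.\<close>
  define N where "N w = (LEAST n. w \<in> C n)" for w
  define G where "G w = rep f (restrict_to (C (N w)) X) w" for w
  have N: "N \<in> measurable F (count_space UNIV)"
    unfolding N_def by measurable
  have "G \<in> borel_measurable F"
    unfolding G_def by (rule measurable_compose_countable[OF rep_f(1)[OF CX] N])
  moreover have "AE w in M. w \<in> A \<longrightarrow> G w = rep f (restrict_to A X) w"
    if A: "A \<in> sets F" and AX: "restrict_to A X \<in> Lp_fun M p" for A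
  proof -
    \<comment> \<open>Both truncations equal \<open>X\<close> on \<open>C n \<inter> A\<close>,
      which belongs to \<open>F\<close>.\<close>
    have "AE w in M. w \<in> C n \<inter> A \<longrightarrow>
        rep f (restrict_to (C n) X) w = rep f (restrict_to A X) w" for n
      by (rule Lp_locality[OF f_L0 convex CX AX])
         (use A in \<open>auto intro!: AE_I2 simp: restrict_to_def\<close>)
    then have "AE w in M. \<forall>n. w \<in> C n \<inter> A \<longrightarrow>
        rep f (restrict_to (C n) X) w = rep f (restrict_to A X) w"
      unfolding AE_all_countable by blast
    moreover have "AE w in M. \<exists>n. w \<in> C n"
      using C by (simp add: exhausts_def)
    ultimately show ?thesis
    proof eventually_elim
      case (elim w)
      have "w \<in> C (N w)"
        unfolding N_def using elim(2) by (rule LeastI_ex)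
      then show ?case
        using elim(1) by (auto simp: G_def)
    qed
  qed
  ultimately show ?thesis
    by (auto simp: glued_def)
qed

section \<open>Properties of glued functions, checked on common exhausting sequences\<close>

lemma glued_antimono:
  assumes X: "X \<in> LpF_fun M F p" and Y: "Y \<in> LpF_fun M F p"
    and G: "glued X G" and H: "glued Y H" and le: "AE w in M. Y w \<le> X w"
  shows "AE w in M. G w \<le> H w"
proof -
  obtain C where C: "exhausts C" and CX: "\<And>n. restrict_to (C n) X \<in> Lp_fun M p"
    and CY: "\<And>n. restrict_to (C n) Y \<in> Lp_fun M p"
    using LpF_fun_exhaust2[OF X Y] by blast
  show ?thesis
  proof (rule exhausts_AE[OF C])
    fix n
    note Cn = exhausts_sets[OF C, of n] and CXn = CX[of n] and CYn = CY[of n]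
    have "AE w in M. restrict_to (C n) Y w \<le> restrict_to (C n) X w"
      using le by eventually_elim (simp add: restrict_to_def mult_left_mono)
    from rep_f_antimono[OF CXn CYn this] gluedD[OF G Cn CXn]
      gluedD[OF H Cn CYn]
    show "AE w in M. w \<in> C n \<longrightarrow> G w \<le> H w"
      by eventually_elim simp
  qed
qed

text \<open>Monotonicity used in both directions. It makes the class of a glued function depend only
  on the class of \<open>X\<close>, as a definition on classes demands.\<close>

lemma glued_unique:
  assumes X: "X \<in> LpF_fun M F p" and Y: "Y \<in> LpF_fun M F p"
    and G: "glued X G" and H: "glued Y H" and eq: "AE w in M. X w = Y w"
  shows "AE w in M. G w = H w"
proof -
  have "AE w in M. Y w \<le> X w" "AE w in M. X w \<le> Y w"
    using eq by (eventually_elim, simp)+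
  from glued_antimono[OF X Y G H this(1)] glued_antimono[OF Y X H G this(2)]
  show ?thesis by eventually_elim simp
qed

text \<open>Here \<open>Y\<close> is an arbitrary \<open>F\<close>-measurable function, while
  \<open>f\<close> translates only by p-integrable ones. Its restrictions to the pieces are
  p-integrable and still \<open>F\<close>-measurable, so the translation property of
  \<open>f\<close> applies to them.\<close>

lemma glued_translate:
  assumes X: "X \<in> LpF_fun M F p" and Y: "Y \<in> borel_measurable F"
    and G: "glued X G" and H: "glued (\<lambda>w. X w + Y w) H"
  shows "AE w in M. H w = G w - Y w"
proof -
  obtain C where C: "exhausts C" and CX: "\<And>n. restrict_to (C n) X \<in> Lp_fun M p"
    and CY: "\<And>n. restrict_to (C n) Y \<in> Lp_fun M p"
    using LpF_fun_exhaust2[OF X F_measurable_imp_LpF_fun[OF Y]] by blast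
  show ?thesis
  proof (rule exhausts_AE[OF C])
    fix n
    note Cn = exhausts_sets[OF C, of n] and CXn = CX[of n] and CYn = CY[of n]
    have eq: "restrict_to (C n) (\<lambda>w. X w + Y w) = (\<lambda>w. restrict_to (C n) X w + restrict_to (C n) Y w)"
      by (auto simp: restrict_to_def algebra_simps)
    have "AE w in M. w \<in> C n \<longrightarrow> H w = rep f (restrict_to (C n) (\<lambda>w. X w + Y w)) w"
      by (rule gluedD[OF H Cn]) (simp only: eq Lp_fun_add[OF CXn CYn p_nonneg])
    with gluedD[OF G Cn CXn]
      rep_f_translate[OF CXn CYn restrict_to_measurable[OF Cn Y]]
    show "AE w in M. w \<in> C n \<longrightarrow> H w = G w - Y w"
      unfolding eq by eventually_elim (simp add: restrict_to_def)
  qed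
qed

lemma glued_convex:
  assumes X: "X \<in> LpF_fun M F p" and Y: "Y \<in> LpF_fun M F p"
    and t: "t \<in> borel_measurable F" and t01: "AE w in M. 0 \<le> t w \<and> t w \<le> 1"
    and G: "glued X G" and H: "glued Y H" and K: "glued (\<lambda>w. t w * X w + (1 - t w) * Y w) K"
  shows "AE w in M. K w \<le> t w * G w + (1 - t w) * H w"
proof -
  obtain C where C: "exhausts C" and CX: "\<And>n. restrict_to (C n) X \<in> Lp_fun M p"
    and CY: "\<And>n. restrict_to (C n) Y \<in> Lp_fun M p"
    using LpF_fun_exhaust2[OF X Y] by blast
  show ?thesis
  proof (rule exhausts_AE[OF C])
    fix n
    note Cn = exhausts_sets[OF C, of n] and CXn = CX[of n] and CYn = CY[of n]
    have comb: "(\<lambda>w. t w * restrict_to (C n) X w + (1 - t w) * restrict_to (C n) Y w) \<in> Lp_fun M p"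
      by (rule Lp_fun_convex_combination[OF CXn CYn p_nonneg F_measurable[OF t] t01])
    have "AE w in M. w \<in> C n \<longrightarrow>
        K w = rep f (restrict_to (C n) (\<lambda>w. t w * X w + (1 - t w) * Y w)) w"
      by (rule gluedD[OF K Cn])
         (simp only: restrict_to_convex_combination comb)
    moreover have "Lp_fun M p \<subseteq> borel_measurable M"
      using Lp_fun_measurable by blast
    note convex_rep[OF this f_L0[unfolded Lp_eq_image] convex[unfolded Lp_eq_image] CXn CYn t t01 comb]
    ultimately show "AE w in M. w \<in> C n \<longrightarrow> K w \<le> t w * G w + (1 - t w) * H w"
      using gluedD[OF G Cn CXn] gluedD[OF H Cn CYn]
      unfolding restrict_to_convex_combination by eventually_elim simp
  qed
qed

text \<open>Locality compares \<open>X\<close> with its own truncation. This is why the extension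
  returns \<open>f\<close> on \<open>Lp M M p\<close>.\<close>

lemma glued_rep_f:
  assumes X: "X \<in> Lp_fun M p"
  shows "glued X (rep f X)"
  unfolding glued_def
proof (intro conjI ballI impI)
  fix A assume A: "A \<in> sets F" "restrict_to A X \<in> Lp_fun M p"
  show "AE w in M. w \<in> A \<longrightarrow> rep f X w = rep f (restrict_to A X) w"
    by (rule Lp_locality[OF f_L0 convex X A(2,1)]) (auto simp: restrict_to_def)
qed (rule rep_f(1)[OF X])

text \<open>By locality every admissible extension is glued from \<open>f\<close>; this is the uniqueness half.\<close>

lemma glued_rep_extension:
  assumes g: "g \<in> Lp_cond M F p \<rightarrow> L0 M F" and conv: "L0_convex_on M F (Lp_cond M F p) g"
    and ext: "\<forall>x\<in>Lp M M p. g x = f x" and X: "X \<in> LpF_fun M F p"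
  shows "glued X (rep g X)"
  unfolding glued_def
proof (intro conjI ballI impI)
  show "rep g X \<in> borel_measurable F"
    by (rule rep(1)) (use g class_Lp_cond[OF X] in blast)
  fix A assume A: "A \<in> sets F" "restrict_to A X \<in> Lp_fun M p"
  \<comment> \<open>\<open>rep\<close> uses its map only through the value at the class, where
    \<open>g\<close> and \<open>f\<close> coincide; the two choices are therefore the same
    function.\<close>
  have "rep g (restrict_to A X) = rep f (restrict_to A X)"
    using ext class_Lp[OF A(2)] by (simp add: rep_def)
  moreover have "AE w in M. w \<in> A \<longrightarrow> rep g X w = rep g (restrict_to A X) w"
    by (rule LpF_locality[OF g conv X Lp_fun_imp_LpF_fun[OF A(2)] A(1)])
       (auto simp: restrict_to_def)
  ultimately show "AE w in M. w \<in> A \<longrightarrow> rep g X w = rep f (restrict_to A X) w"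
    by simp
qed

section \<open>The extension as a map on classes\<close>

definition extension :: "('a \<Rightarrow> real) set \<Rightarrow> ('a \<Rightarrow> real) set" where
  "extension = (\<lambda>x\<in>Lp_cond M F p. THE y. \<exists>X\<in>LpF_fun M F p. \<exists>G. x = ae_class M X \<and> glued X G \<and> y = ae_class M G)"

text \<open>Two representatives of a class agree a.e., and then so do their glued functions by
  \<open>glued_unique\<close>; the description in \<open>extension\<close> thus determines one
  class. Any representative and any function glued to it may be used to compute the value.\<close>

lemma extension_class:
  assumes X: "X \<in> LpF_fun M F p" and G: "glued X G"
  shows "extension (ae_class M X) = ae_class M G"
proof -
  have "(THE y. \<exists>Y\<in>LpF_fun M F p. \<exists>H. ae_class M X = ae_class M Y \<and> glued Y H \<and> y = ae_class M H) =
      ae_class M G"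
  proof (rule the_equality)
    show "\<exists>Y\<in>LpF_fun M F p. \<exists>H. ae_class M X = ae_class M Y \<and> glued Y H \<and> ae_class M G = ae_class M H"
      using X G by blast
    fix y assume "\<exists>Y\<in>LpF_fun M F p. \<exists>H. ae_class M X = ae_class M Y \<and> glued Y H \<and> y = ae_class M H"
    then obtain Y H where Y: "Y \<in> LpF_fun M F p" "ae_class M X = ae_class M Y"
      and H: "glued Y H" "y = ae_class M H"
      by blast
    have "AE w in M. X w = Y w"
      using Y(2) by (simp only: ae_class_eq_iff[OF LpF_fun_measurable[OF X] LpF_fun_measurable[OF Y(1)]])
    from glued_unique[OF X Y(1) G H(1) this]
    show "y = ae_class M G"
      unfolding H(2) ae_class_eq_iff[OF glued_measurable(2)[OF H(1)] glued_measurable(2)[OF G]]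
      by eventually_elim simp
  qed
  then show ?thesis
    using class_Lp_cond[OF X] by (simp add: extension_def)
qed

lemma Lp_condE:
  assumes "x \<in> Lp_cond M F p"
  obtains X G where "X \<in> LpF_fun M F p" "X \<in> borel_measurable M" "x = ae_class M X"
    "glued X G" "G \<in> borel_measurable F" "G \<in> borel_measurable M" "extension x = ae_class M G"
proof -
  obtain X where X: "X \<in> LpF_fun M F p" "x = ae_class M X"
    using assms by (auto simp: Lp_cond_eq_image)
  obtain G where G: "glued X G"
    using glued_exists[OF X(1)] by blast
  show thesis
    by (rule that[OF X(1) LpF_fun_measurable[OF X(1)] X(2) G glued_measurable[OF G]])
       (simp only: X(2) extension_class[OF X(1) G])
qed

lemma extension_risk: "LpF_cond_risk_measure M F p extension"
  unfolding LpF_cond_risk_measure_def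
proof (intro conjI ballI impI Pi_I)
  fix x assume x: "x \<in> Lp_cond M F p"
  then show "extension x \<in> L0 M F"
    by (rule Lp_condE) (auto simp only: L0_iff)
next
  fix x y assume x: "x \<in> Lp_cond M F p" and y: "y \<in> Lp_cond M F p" and le: "ae_le M y x"
  obtain X G where X: "X \<in> LpF_fun M F p" "X \<in> borel_measurable M" "x = ae_class M X"
    "glued X G" "G \<in> borel_measurable M" "extension x = ae_class M G"
    using x by (rule Lp_condE)
  obtain Y H where Y: "Y \<in> LpF_fun M F p" "Y \<in> borel_measurable M" "y = ae_class M Y"
    "glued Y H" "H \<in> borel_measurable M" "extension y = ae_class M H"
    using y by (rule Lp_condE)
  have "AE w in M. Y w \<le> X w"
    using le unfolding X(3) Y(3) ae_le_ae_class[OF Y(2) X(2)] .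
  from glued_antimono[OF X(1) Y(1) X(4) Y(4) this]
  show "ae_le M (extension x) (extension y)"
    unfolding X(6) Y(6) ae_le_ae_class[OF X(5) Y(5)] .
next
  fix x y assume x: "x \<in> Lp_cond M F p" and y: "y \<in> L0 M F"
  obtain X G where X: "X \<in> LpF_fun M F p" "X \<in> borel_measurable M" "x = ae_class M X"
    "glued X G" "G \<in> borel_measurable M" "extension x = ae_class M G"
    using x by (rule Lp_condE)
  obtain Y where Y: "Y \<in> borel_measurable F" "y = ae_class M Y"
    using y by (auto simp: L0_iff)
  note YM [measurable] = F_measurable[OF Y(1)]
  note [measurable] = X(5)
  have XY: "(\<lambda>w. X w + Y w) \<in> LpF_fun M F p"
    using LpF_fun_add[OF X(1) F_measurable_imp_LpF_fun[OF Y(1)]] .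
  obtain H where H: "glued (\<lambda>w. X w + Y w) H"
    using glued_exists[OF XY] by blast
  have "(\<lambda>w. G w - Y w) \<in> borel_measurable M"
    by measurable
  then have "ae_class M H = ae_class M (\<lambda>w. G w - Y w)"
    using glued_translate[OF X(1) Y(1) X(4) H]
    by (simp only: ae_class_eq_iff[OF glued_measurable(2)[OF H]])
  then show "extension (ae_plus M x y) = ae_minus M (extension x) y"
    unfolding X(6) unfolding X(3) Y(2) ae_arith_class(1)[OF X(2) YM] ae_arith_class(2)[OF X(5) YM]
      extension_class[OF XY H] .
qed

lemma extension_convex: "L0_convex_on M F (Lp_cond M F p) extension"
  unfolding L0_convex_on_def
proof (intro ballI impI)
  fix x y \<xi> assume x: "x \<in> Lp_cond M F p" and y: "y \<in> Lp_cond M F p"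
    and \<xi>: "\<xi> \<in> L0_plus M F" "ae_le M \<xi> (ae_one M)"
  obtain X G where X: "X \<in> LpF_fun M F p" "X \<in> borel_measurable M" "x = ae_class M X"
    "glued X G" "G \<in> borel_measurable M" "extension x = ae_class M G"
    using x by (rule Lp_condE)
  obtain Y H where Y: "Y \<in> LpF_fun M F p" "Y \<in> borel_measurable M" "y = ae_class M Y"
    "glued Y H" "H \<in> borel_measurable M" "extension y = ae_class M H"
    using y by (rule Lp_condE)
  obtain t where t: "t \<in> borel_measurable F" "\<xi> = ae_class M t"
    using \<xi>(1) by (auto simp: L0_plus_def L0_iff)
  note tM = F_measurable[OF t(1)]
  have "AE w in M. 0 \<le> t w" "AE w in M. t w \<le> 1"
    using \<xi> tM by (simp_all add: L0_plus_def t(2) ae_le_ae_class)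
  then have t01: "AE w in M. 0 \<le> t w \<and> t w \<le> 1"
    by eventually_elim simp
  note Z = LpF_fun_convex_combination[OF X(1) Y(1) tM t01]
  obtain K where K: "glued (\<lambda>w. t w * X w + (1 - t w) * Y w) K"
    using glued_exists[OF Z] by blast
  have "(\<lambda>w. t w * G w + (1 - t w) * H w) \<in> borel_measurable M"
    using tM X(5) Y(5) by measurable
  then have "ae_le M (ae_class M K) (ae_class M (\<lambda>w. t w * G w + (1 - t w) * H w))"
    using glued_convex[OF X(1) Y(1) t(1) t01 X(4) Y(4) K]
    by (simp only: ae_le_ae_class[OF glued_measurable(2)[OF K]])
  then show "ae_le M (extension (ae_plus M (ae_times M \<xi> x) (ae_times M (ae_minus M (ae_one M) \<xi>) y)))
      (ae_plus M (ae_times M \<xi> (extension x)) (ae_times M (ae_minus M (ae_one M) \<xi>) (extension y)))"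
    unfolding X(6) Y(6) unfolding X(3) Y(3) t(2)
      ae_convex_class[OF tM X(2) Y(2)] ae_convex_class[OF tM X(5) Y(5)] extension_class[OF Z K] .
qed

lemma extension_extends: "x \<in> Lp M M p \<Longrightarrow> extension x = f x"
  by (auto simp: Lp_eq_image rep_f extension_class[OF Lp_fun_imp_LpF_fun glued_rep_f])

text \<open>By \<open>glued_rep_extension\<close> the representative of \<open>g\<close> at
  \<open>X\<close> is glued to \<open>X\<close>, and \<open>extension_class\<close> computes the
  value of \<open>extension\<close> from any such function.\<close>

lemma extension_unique:
  assumes "g \<in> extensional (Lp_cond M F p)" "LpF_cond_risk_measure M F p g"
    and conv: "L0_convex_on M F (Lp_cond M F p) g" and ext: "\<forall>x\<in>Lp M M p. g x = f x"
  shows "g = extension"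
proof (rule extensionalityI[OF assms(1)])
  show "extension \<in> extensional (Lp_cond M F p)"
    by (simp add: extension_def)
  have g: "g \<in> Lp_cond M F p \<rightarrow> L0 M F"
    using assms(2) by (simp add: LpF_cond_risk_measure_def)
  fix x assume x: "x \<in> Lp_cond M F p"
  then obtain X where X: "X \<in> LpF_fun M F p" "x = ae_class M X"
    by (auto simp: Lp_cond_eq_image)
  have "g (ae_class M X) \<in> L0 M F"
    using g x X(2) by blast
  from rep(2)[where g = g and X = X, OF this]
  show "g x = extension x"
    unfolding X(2) extension_class[OF X(1) glued_rep_extension[OF g conv ext X(1)]] .
qed

end

text \<open>Functions in HOL are total, so uniqueness is claimed among those that are
  \<open>undefined\<close> off \<open>Lp_cond M F p\<close>; this is the purpose of
  \<open>extensional\<close>.\<close>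

theorem theorem4p28:
  fixes M F :: "'a measure" and p r :: real
    and f :: "('a \<Rightarrow> real) set \<Rightarrow> ('a \<Rightarrow> real) set"
  assumes "prob_space M" and "subalgebra M F"
    and "1 \<le> r" and "r \<le> p"
    and "Lp_cond_risk_measure M F p r f"
    and "L0_convex_on M F (Lp M M p) f"
  shows "\<exists>!g. g \<in> extensional (Lp_cond M F p) \<and>
    LpF_cond_risk_measure M F p g \<and> L0_convex_on M F (Lp_cond M F p) g \<and>
    (\<forall>x\<in>Lp M M p. g x = f x)"
proof -
  interpret prob_space M by fact
  interpret convex_risk_measure M F p r f
    using assms by unfold_locales auto
  show ?thesis
  proof (rule ex1I[of _ extension])
    show "extension \<in> extensional (Lp_cond M F p) \<and> LpF_cond_risk_measure M F p extension \<and>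
        L0_convex_on M F (Lp_cond M F p) extension \<and> (\<forall>x\<in>Lp M M p. extension x = f x)"
      using extension_risk extension_convex extension_extends by (simp add: extension_def)
  qed (use extension_unique in blast)
qed

end
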